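(* Let $n\ge 1$, let $S\subset\{1,\dots,n\}$, and let $m=|S|$ and $I_m=\{1,\dots,m\}$. Then $$\sum_{i\in S,\;j\in\{1,\dots,n\}\setminus S}\frac{1}{|x_{n,i}-x_{n,j}|}\;\ge\;\sum_{i\in I_m,\;j\in\{1,\dots,n\}\setminus I_m}\frac{1}{|x_{n,i}-x_{n,j}|},$$ where $x_{n,i}=(2n)^{-1/2}\xi_{n,i}$ and $\xi_{n,1}<\xi_{n,2}<\dots<\xi_{n,n}$ are the roots of the $n$-th Hermite polynomial $H_n$.
   Context: The Hermite polynomials are the (physicists') ones: $H_0(x)=1$, $H_1(x)=2x$, $H_{n+1}(x)=2xH_n(x)-2nH_{n-1}(x)$ for $n\ge1$. Each $H_n$ has $n$ simple real roots, listed in increasing order as $\xi_{n,1}<\dots<\xi_{n,n}$. For $m=0$, $I_0=\emptyset$; empty sums are $0$. *)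

theory Defs
  imports Complex_Main "HOL-Computational_Algebra.Polynomial"
begin

text \<open>The physicists' Hermite polynomials.\<close>

fun hermite :: "nat \<Rightarrow> real poly" where
  "hermite 0 = 1"
| "hermite (Suc 0) = [:0, 2:]"
| "hermite (Suc (Suc n)) = [:0, 2:] * hermite (Suc n) - smult (2 * real (Suc n)) (hermite n)"

text \<open>Root indices are 1-based and meaningful for \<open>1 \<le> i \<le> n\<close>; the roots of
  \<open>hermite n\<close> are real and simple, so the list below has length \<open>n\<close>.\<close>

definition hermite_root :: "nat \<Rightarrow> nat \<Rightarrow> real" where
  "hermite_root n i = sorted_list_of_set {x. poly (hermite n) x = 0} ! (i - 1)"

definition scaled_hermite_root :: "nat \<Rightarrow> nat \<Rightarrow> real" where
  "scaled_hermite_root n i = (2 * real n) powr (- 1 / 2) * hermite_root n i"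

end

theory Submission
  imports Defs
begin

text \<open>
  The Hermite equation at a zero gives Stieltjes' relation
  \<open>(\<Sum>j\<noteq>i. 1 / (x i - x j)) = x i\<close>, and Sturm comparison shows that the gaps between zeros
  shrink towards the centre. These two facts and the symmetry of the zeros suffice.

  Stieltjes' relation evaluates the change of the cut when a block \<open>{u<..v}\<close> of selected indices,
  all others being unselected, moves one place to the left: it is \<open>- drift u v\<close>. The drift vanishes
  for \<open>u = v\<close>, and it grows when the block is widened on both sides, because gaps on the left
  of the centre exceed their counterparts on the right. Hence blocks left of the centre want to move
  further left.

  For general \<open>S\<close>, two-point rearrangement under the reflection \<open>i \<mapsto> n + 1 - i\<close> allows one to
  assume that of every mirror pair with a single selected index the left one is selected. Then
  either the last block of \<open>S\<close> meeting the left half can move left, every selected index to its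
  right being dominated by its mirror image, or the unselected gap following that block can move
  right, by the same lemma for the mirror image of the complement. Either move lowers \<open>\<Sum>S\<close>, so the
  process ends at an initial segment.
\<close>

section \<open>Cuts of balanced point configurations\<close>

text \<open>Since \<open>1 / b - 1 / (b + e) = e / (b * (b + e))\<close>, the drop is decreasing in
  \<open>b\<close> and increasing in \<open>e\<close>. This compares how two weights change when an
  endpoint moves.\<close>

lemma inverse_diff_mono:
  fixes a b d e :: real
  assumes "0 < a" "a \<le> b" "0 \<le> e" "e \<le> d"
  shows "1 / b - 1 / (b + e) \<le> 1 / a - 1 / (a + d)"
proof -
  have "1 / b - 1 / (b + e) = e / (b * (b + e))"
    using assms by (simp add: field_simps)
  also have "\<dots> = (e / (b + e)) / b"
    by simp
  also have "\<dots> \<le> (d / (b + d)) / b"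
    using assms by (intro divide_right_mono) (auto simp: divide_simps algebra_simps mult_left_mono)
  also have "\<dots> \<le> (d / (a + d)) / a"
    using assms by (intro frac_le) (auto intro!: divide_left_mono)
  also have "\<dots> = 1 / a - 1 / (a + d)"
    using assms by (simp add: field_simps)
  finally show ?thesis .
qed

text \<open>These are the only facts about the zeros that the combinatorial argument uses. In
  \<open>gap_mono\<close> the conditions place gap \<open>j\<close> between gap \<open>i\<close> and
  its mirror image, gap \<open>n - i\<close>, so it is at least as central. The zeros are left
  unscaled, which makes the constant in \<open>balance\<close> equal to 1.\<close>

locale balanced_points =
  fixes n :: nat and x :: "nat \<Rightarrow> real"
  assumes x_less: "\<And>i j. 1 \<le> i \<Longrightarrow> i < j \<Longrightarrow> j \<le> n \<Longrightarrow> x i < x j"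
    and x_mirror: "\<And>i. 1 \<le> i \<Longrightarrow> i \<le> n \<Longrightarrow> x (n + 1 - i) = - x i"
    and gap_mono: "\<And>i j. 1 \<le> i \<Longrightarrow> i \<le> j \<Longrightarrow> i + j \<le> n \<Longrightarrow> x (j + 1) - x j \<le> x (i + 1) - x i"
    and balance: "\<And>i. 1 \<le> i \<Longrightarrow> i \<le> n \<Longrightarrow> (\<Sum>j\<in>{1..n} - {i}. 1 / (x i - x j)) = x i"
begin

definition w :: "nat \<Rightarrow> nat \<Rightarrow> real" where
  "w i j = 1 / \<bar>x i - x j\<bar>"

definition cut :: "nat set \<Rightarrow> real" where
  "cut S = (\<Sum>i\<in>S. \<Sum>j\<in>{1..n} - S. w i j)"

text \<open>The balance relations have been used to eliminate the sum over the interior of the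
  block. Each endpoint keeps only the sum beyond the opposite end, a form suited to widening the
  block.\<close>

definition drift :: "nat \<Rightarrow> nat \<Rightarrow> real" where
  "drift u v = 2 * (\<Sum>k\<in>{1..<u}. w v k) - 2 * (\<Sum>k\<in>{v<..n}. w u k) - (x u + x v)"

section \<open>Weights and the balance relation\<close>

lemma w_commute: "w i j = w j i"
  by (simp add: w_def abs_minus_commute)

lemma w_self [simp]: "w i i = 0"
  by (simp add: w_def)

lemma w_less: "1 \<le> i \<Longrightarrow> i < j \<Longrightarrow> j \<le> n \<Longrightarrow> w i j = 1 / (x j - x i)"
  using x_less[of i j] by (simp add: w_def)

lemma w_greater: "1 \<le> j \<Longrightarrow> j < i \<Longrightarrow> i \<le> n \<Longrightarrow> w i j = 1 / (x i - x j)"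
  using x_less[of j i] by (simp add: w_def)

lemma x_le: "1 \<le> i \<Longrightarrow> i \<le> j \<Longrightarrow> j \<le> n \<Longrightarrow> x i \<le> x j"
  using x_less[of i j] by (cases "i = j") auto

lemma balance_w:
  assumes "1 \<le> i" "i \<le> n"
  shows "(\<Sum>k\<in>{1..<i}. w i k) - (\<Sum>k\<in>{i<..n}. w i k) = x i"
proof -
  have split: "{1..n} - {i} = {1..<i} \<union> {i<..n}"
    using assms by auto
  have "x i = (\<Sum>j\<in>{1..<i}. 1 / (x i - x j)) + (\<Sum>j\<in>{i<..n}. 1 / (x i - x j))"
    using balance[OF assms] unfolding split by (subst (asm) sum.union_disjoint) auto
  also have "(\<Sum>j\<in>{1..<i}. 1 / (x i - x j)) = (\<Sum>k\<in>{1..<i}. w i k)"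
    using assms by (intro sum.cong) (auto simp: w_greater)
  also have "(\<Sum>j\<in>{i<..n}. 1 / (x i - x j)) = (\<Sum>k\<in>{i<..n}. - w i k)"
    using assms by (intro sum.cong) (auto simp: w_less minus_divide_right)
  finally show ?thesis
    by (simp add: sum_negf)
qed

text \<open>Adding the balance relations at \<open>u\<close> and \<open>v\<close> cancels the two
  copies of \<open>w u v\<close>. The right-hand side is the decrease of the cut when
  \<open>v\<close> is exchanged for \<open>u\<close> and only the block is selected.\<close>

lemma drift_alt:
  assumes "1 \<le> u" "u < v" "v \<le> n"
  shows "drift u v = (\<Sum>k\<in>{u<..<v}. w u k - w v k) + (\<Sum>k\<in>{v<..n}. w v k - w u k)
           - (\<Sum>k\<in>{1..<u}. w u k - w v k)"
proof -
  have 1: "{1..<v} = insert u ({1..<u} \<union> {u<..<v})" "{u<..n} = insert v ({v<..n} \<union> {u<..<v})"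
    using assms by auto
  have "(\<Sum>k\<in>{1..<v}. w v k) = w v u + ((\<Sum>k\<in>{1..<u}. w v k) + (\<Sum>k\<in>{u<..<v}. w v k))"
    unfolding 1 by (subst sum.insert) (auto intro!: sum.union_disjoint)
  moreover have "(\<Sum>k\<in>{u<..n}. w u k) = w u v + ((\<Sum>k\<in>{v<..n}. w u k) + (\<Sum>k\<in>{u<..<v}. w u k))"
    unfolding 1 by (subst sum.insert) (auto intro!: sum.union_disjoint)
  ultimately show ?thesis
    using balance_w[of u] balance_w[of v] assms w_commute[of u v]
    unfolding drift_def sum_subtractf by linarith
qed

section \<open>Nonnegativity of the drift\<close>

text \<open>Both sides telescope into \<open>s\<close> gaps. Gap \<open>b + t\<close> is paired with
  gap \<open>a - Suc t\<close>; the indices of a pair always add up to \<open>a + b - 1\<close>, so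
  \<open>gap_mono\<close> applies to each pair.\<close>

lemma span_mono:
  assumes "s < a" "a \<le> b + 1" "a + b \<le> n + 1"
  shows "x (b + s) - x b \<le> x a - x (a - s)"
  using assms
proof (induction s)
  case (Suc s)
  then have "x (b + s + 1) - x (b + s) \<le> x (a - Suc s + 1) - x (a - Suc s)"
    by (intro gap_mono) auto
  moreover have "a - Suc s + 1 = a - s"
    using Suc.prems by simp
  ultimately show ?case
    using Suc by auto
qed simp

lemma drift_self:
  assumes "1 \<le> u" "u \<le> n"
  shows "drift u u = 0"
  using balance_w[OF assms] by (simp add: drift_def)

text \<open>Each left index \<open>u - s\<close> is matched with \<open>v + s\<close>. The bound on
  \<open>u + v\<close> leaves room for all the matches, and unmatched terms on the right only
  help.\<close>

lemma sum_left_le_sum_right: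
  assumes "u \<le> v" "u + v \<le> n + 1"
    and f: "\<And>s. 1 \<le> s \<Longrightarrow> s < u \<Longrightarrow> f (u - s) \<le> g (v + s)"
    and g: "\<And>k. v < k \<Longrightarrow> k \<le> n \<Longrightarrow> 0 \<le> g k"
  shows "(\<Sum>k\<in>{1..<u}. f k) \<le> (\<Sum>k\<in>{v<..n}. g k :: real)"
proof -
  have "(\<Sum>k\<in>{1..<u}. f k) = (\<Sum>s\<in>{1..<u}. f (u - s))"
    by (rule sum.reindex_bij_witness[of _ "\<lambda>s. u - s" "\<lambda>s. u - s"]) auto
  also have "\<dots> \<le> (\<Sum>s\<in>{1..<u}. g (v + s))"
    by (intro sum_mono f) auto
  also have "\<dots> = (\<Sum>k\<in>(+) v ` {1..<u}. g k)"
    by (subst sum.reindex) (auto simp: inj_on_def)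
  also have "\<dots> \<le> (\<Sum>k\<in>{v<..n}. g k)"
    using assms by (intro sum_mono2 g) auto
  finally show ?thesis .
qed

lemma w_decreasing_right:
  assumes "1 \<le> u" "u \<le> v" "v < k" "k \<le> n"
  shows "w u k \<le> w v k"
  using assms x_less[of u k] x_less[of v k] x_le[of u v] by (simp add: w_less frac_le)

lemma w_decreasing_left:
  assumes "1 \<le> k" "k < u" "u \<le> v" "v \<le> n"
  shows "w v k \<le> w u k"
  using assms x_less[of k u] x_less[of k v] x_le[of u v] by (simp add: w_greater frac_le)

text \<open>There is no interior sum. After reflection about the pair, a point on the right is at
  least as close to it as its partner on the left, so its weight changes more over the same distance
  \<open>x (Suc u) - x u\<close>.\<close>

lemma drift_adjacent:
  assumes "1 \<le> u" "u + Suc u \<le> n + 1"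
  shows "0 \<le> drift u (Suc u)"
proof -
  have "(\<Sum>k\<in>{1..<u}. w u k - w (Suc u) k) \<le> (\<Sum>k\<in>{Suc u<..n}. w (Suc u) k - w u k)"
  proof (rule sum_left_le_sum_right)
    fix s assume s: "1 \<le> s" "s < u"
    let ?i = "u - s" and ?j = "Suc u + s" and ?d = "x (Suc u) - x u"
    have d: "x (Suc u) - x u > 0" "x ?j - x (Suc u) > 0" "x u - x ?i > 0"
      using s assms by (auto intro!: x_less)
    have "1 / (x u - x ?i) - 1 / (x u - x ?i + ?d) \<le> 1 / (x ?j - x (Suc u)) - 1 / (x ?j - x (Suc u) + ?d)"
      using d s assms span_mono[of s u "Suc u"] by (intro inverse_diff_mono) auto
    then show "w u ?i - w (Suc u) ?i \<le> w (Suc u) ?j - w u ?j"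
      using s assms by (simp add: w_less w_greater)
  qed (use assms w_decreasing_right in auto)
  moreover have "{u<..<Suc u} = {}"
    by auto
  ultimately show ?thesis
    using assms by (simp add: drift_alt)
qed

text \<open>The increment of the drift splits into three nonnegative parts: twice the difference of
  the outer sums, twice \<open>w (p + 1) (q + 1) - w q p\<close>, and the difference of the gaps at
  \<open>p\<close> and \<open>q\<close>.\<close>

lemma drift_widen:
  assumes "1 \<le> p" "p < q" "p + (q + 1) \<le> n + 1"
  shows "drift (p + 1) q \<le> drift p (q + 1)"
proof -
  let ?P = "p + 1" and ?Q = "q + 1"
  have gap: "x ?Q - x q \<le> x ?P - x p"
    using assms by (intro gap_mono) auto
  have pos: "x ?Q - x q > 0"
    using assms by (auto intro!: x_less)
  have "(\<Sum>k\<in>{1..<p}. w q k - w ?Q k) \<le> (\<Sum>k\<in>{?Q<..n}. w ?P k - w p k)"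
  proof (rule sum_left_le_sum_right)
    fix s assume s: "1 \<le> s" "s < p"
    let ?i = "p - s" and ?j = "?Q + s"
    have d: "x ?j - x ?P > 0"
      using s assms by (auto intro!: x_less)
    \<comment> \<open>Exchanging \<open>x q\<close> and \<open>x ?P\<close> across this inequality
      gives \<open>x ?j - x ?P \<le> x q - x ?i\<close>, the distance comparison needed
      below.\<close>
    have "x (q + Suc s) - x q \<le> x ?P - x (?P - Suc s)"
      using s assms by (intro span_mono) auto
    then have "1 / (x q - x ?i) - 1 / (x q - x ?i + (x ?Q - x q))
        \<le> 1 / (x ?j - x ?P) - 1 / (x ?j - x ?P + (x ?P - x p))"
      using d gap pos s assms by (intro inverse_diff_mono) auto
    then show "w q ?i - w ?Q ?i \<le> w ?P ?j - w p ?j"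
      using s assms by (simp add: w_less w_greater)
  qed (use assms w_decreasing_right in auto)
  moreover have "w q p \<le> w ?P ?Q"
  proof (cases "q = ?P")
    case False
    then have "x ?P < x ?Q" "x p < x q"
      using assms by (auto intro!: x_less)
    then show ?thesis
      using gap assms by (simp add: w_less w_greater frac_le)
  next
    case True
    then show ?thesis
      using gap assms pos by (simp add: w_less w_greater frac_le)
  qed
  moreover have "{1..<?P} = insert p {1..<p}" "{q<..n} = insert ?Q {?Q<..n}"
    using assms by auto
  then have "(\<Sum>k\<in>{1..<?P}. w q k) = w q p + (\<Sum>k\<in>{1..<p}. w q k)"
    "(\<Sum>k\<in>{q<..n}. w ?P k) = w ?P ?Q + (\<Sum>k\<in>{?Q<..n}. w ?P k)"
    by auto
  ultimately show ?thesis
    using gap unfolding drift_def sum_subtractf by argo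
qed

text \<open>Indices are peeled off both ends, which keeps \<open>u + v\<close> fixed. Depending on
  parity the process stops at a single index or at an adjacent pair.\<close>

lemma drift_nonneg:
  assumes "1 \<le> u" "u \<le> v" "u + v \<le> n + 1"
  shows "0 \<le> drift u v"
  using assms
proof (induction "v - u" arbitrary: u v rule: less_induct)
  case less
  consider "v = u" | "v = Suc u" | q where "v = q + 1" "u + 1 \<le> q"
    using less.prems by (metis Suc_eq_plus1 Suc_leI le_Suc_ex add_Suc_right le_add1 le_neq_implies_less less_iff_Suc_add)
  then show ?case
  proof cases
    case 1
    then show ?thesis
      using less.prems by (simp add: drift_self)
  next
    case 2
    then show ?thesis
      using less.prems by (auto intro: drift_adjacent)
  next
    case 3
    then have "0 \<le> drift (u + 1) q"
      using less.prems by (intro less.hyps) auto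
    also have "\<dots> \<le> drift u v"
      unfolding 3 using 3 less.prems by (intro drift_widen) auto
    finally show ?thesis .
  qed
qed

section \<open>Change of the cut under exchanges and shifts\<close>

abbreviation mirror :: "nat \<Rightarrow> nat" where
  "mirror i \<equiv> n + 1 - i"

text \<open>Pairs avoiding both \<open>u\<close> and \<open>v\<close>, and the pair
  \<open>u, v\<close> itself, contribute equally to both cuts. A selected \<open>k\<close> pays for
  whichever of \<open>u\<close>, \<open>v\<close> is unselected, an unselected \<open>k\<close> for
  the selected one; hence the sign.\<close>

lemma cut_swap:
  assumes "T \<subseteq> {1..n}" "u \<in> {1..n}" "v \<in> {1..n}" "u \<noteq> v" "u \<notin> T" "v \<notin> T"
  shows "cut (insert v T) - cut (insert u T)
    = (\<Sum>k\<in>{1..n} - {u, v}. (if k \<in> T then 1 else - 1) * (w u k - w v k))"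
proof -
  have fin: "finite T"
    using assms(1) finite_subset by blast
  define R where "R = {1..n} - {u, v} - T"
  have split: "{1..n} - {u, v} = T \<union> R" "T \<inter> R = {}"
    using assms by (auto simp: R_def)
  have fR: "finite R"
    by (simp add: R_def)
  have *: "cut (insert a T) = (\<Sum>i\<in>T. \<Sum>j\<in>R. w i j) + (\<Sum>i\<in>T. w b i) + (\<Sum>j\<in>R. w a j) + w a b"
    if "{a, b} = {u, v}" for a b
  proof -
    have ab: "a \<notin> T" "b \<notin> R" "{1..n} - insert a T = insert b R"
      using that assms by (auto simp: R_def doubleton_eq_iff)
    show ?thesis
      using ab fin fR unfolding cut_def ab(3) by (simp add: sum.distrib w_commute)
  qed
  have "cut (insert v T) - cut (insert u T) = (\<Sum>k\<in>T. w u k - w v k) - (\<Sum>k\<in>R. w u k - w v k)"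
    using *[of v u] *[of u v] w_commute[of u v] by (simp add: sum_subtractf insert_commute)
  also have "\<dots> = (\<Sum>k\<in>T. (if k \<in> T then 1 else - 1) * (w u k - w v k))
      + (\<Sum>k\<in>R. (if k \<in> T then 1 else - 1) * (w u k - w v k))"
    using split(2) unfolding sum_negf[symmetric] diff_conv_add_uminus
    by (intro arg_cong2[where f = "(+)"] sum.cong) auto
  also have "\<dots> = (\<Sum>k\<in>{1..n} - {u, v}. (if k \<in> T then 1 else - 1) * (w u k - w v k))"
    unfolding split(1) using fin fR split(2) by (intro sum.union_disjoint [symmetric]) auto
  finally show ?thesis .
qed

text \<open>The gain is the drift plus corrections for selected indices outside the block: those
  left of \<open>u\<close> help, those right of \<open>v\<close> hurt. Every harmful
  \<open>k\<close> is outweighed by \<open>mirror k\<close>, which is at least as close to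
  \<open>u\<close> as \<open>k\<close> is to \<open>v\<close>.\<close>

lemma cut_shift:
  assumes S: "S \<subseteq> {1..n}" and uv: "1 \<le> u" "u < v" "u + v \<le> n + 1"
    and block: "u \<notin> S" "{u<..v} \<subseteq> S"
    and right: "\<And>k. k \<in> S \<Longrightarrow> v < k \<Longrightarrow> mirror k \<in> S \<and> mirror k < u"
  shows "cut (insert u (S - {v})) \<le> cut S"
proof -
  define T where "T = S - {v}"
  have vn: "v \<le> n"
    using uv by auto
  have fS: "finite S"
    using S finite_subset by blast
  let ?f = "\<lambda>k. (if k \<in> T then 1 else - 1) * (w u k - w v k)"
  have S_eq: "S = insert v T"
    using block uv by (auto simp: T_def)
  have "cut S - cut (insert u T) = (\<Sum>k\<in>{1..n} - {u, v}. ?f k)"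
    unfolding S_eq by (rule cut_swap) (use S uv block vn in \<open>auto simp: T_def\<close>)
  also have "{1..n} - {u, v} = {1..<u} \<union> ({u<..<v} \<union> {v<..n})"
    using uv vn by auto
  also have "(\<Sum>k\<in>\<dots>. ?f k) = (\<Sum>k\<in>{1..<u}. ?f k) + ((\<Sum>k\<in>{u<..<v}. ?f k) + (\<Sum>k\<in>{v<..n}. ?f k))"
    using uv by (subst sum.union_disjoint; (subst sum.union_disjoint)?) auto
  also have "(\<Sum>k\<in>{u<..<v}. ?f k) = (\<Sum>k\<in>{u<..<v}. w u k - w v k)"
    using block by (intro sum.cong) (auto simp: T_def subset_iff)
  \<comment> \<open>All indices outside the block are first counted as unselected, as in
    \<open>drift_alt\<close>; each selected one then needs a correction of twice its term.\<close>
  also have "(\<Sum>k\<in>{1..<u}. ?f k)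
      = - (\<Sum>k\<in>{1..<u}. w u k - w v k) + 2 * (\<Sum>k\<in>S \<inter> {1..<u}. w u k - w v k)"
  proof -
    have "(\<Sum>k\<in>S \<inter> {1..<u}. w u k - w v k) = (\<Sum>k\<in>{1..<u}. if k \<in> S then w u k - w v k else 0)"
      by (subst sum.inter_restrict [symmetric]) (auto simp: Int_commute)
    moreover have "?f k = - (w u k - w v k) + 2 * (if k \<in> S then w u k - w v k else 0)"
      if "k \<in> {1..<u}" for k
      using that uv by (auto simp: T_def)
    then have "(\<Sum>k\<in>{1..<u}. ?f k)
        = (\<Sum>k\<in>{1..<u}. - (w u k - w v k) + 2 * (if k \<in> S then w u k - w v k else 0))"
      by (rule sum.cong[OF refl])
    ultimately show ?thesis
      by (simp only: sum.distrib sum_negf sum_distrib_left [symmetric])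
  qed
  also have "(\<Sum>k\<in>{v<..n}. ?f k)
      = (\<Sum>k\<in>{v<..n}. w v k - w u k) - 2 * (\<Sum>k\<in>S \<inter> {v<..n}. w v k - w u k)"
  proof -
    have "(\<Sum>k\<in>S \<inter> {v<..n}. w v k - w u k) = (\<Sum>k\<in>{v<..n}. if k \<in> S then w v k - w u k else 0)"
      by (subst sum.inter_restrict [symmetric]) (auto simp: Int_commute)
    moreover have "?f k = (w v k - w u k) - 2 * (if k \<in> S then w v k - w u k else 0)"
      if "k \<in> {v<..n}" for k
      using that by (auto simp: T_def)
    then have "(\<Sum>k\<in>{v<..n}. ?f k)
        = (\<Sum>k\<in>{v<..n}. (w v k - w u k) - 2 * (if k \<in> S then w v k - w u k else 0))"
      by (rule sum.cong[OF refl])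
    ultimately show ?thesis
      by (simp only: sum_subtractf sum_distrib_left [symmetric])
  qed
  finally have gain: "cut S - cut (insert u T) = drift u v
      + 2 * ((\<Sum>k\<in>S \<inter> {1..<u}. w u k - w v k) - (\<Sum>k\<in>S \<inter> {v<..n}. w v k - w u k))"
    using uv vn by (simp add: drift_alt)
  \<comment> \<open>\<open>u + v \<le> n + 1\<close> says that \<open>u\<close> is not to the right
    of \<open>mirror v\<close>. The resulting \<open>x u \<le> - x v\<close> is exactly what makes
    \<open>mirror k\<close> the closer partner.\<close>
  have "x u \<le> x (mirror v)"
    using uv by (intro x_le) auto
  then have xuv: "x u \<le> - x v"
    using x_mirror[of v] uv vn by simp
  have "(\<Sum>k\<in>S \<inter> {v<..n}. w v k - w u k)
      \<le> (\<Sum>k\<in>S \<inter> {v<..n}. w u (mirror k) - w v (mirror k))"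
  proof (rule sum_mono)
    fix k assume "k \<in> S \<inter> {v<..n}"
    then have k: "v < k" "k \<le> n" "mirror k < u" "1 \<le> mirror k"
      using right by auto
    have xm: "x (mirror k) = - x k"
      using k uv by (intro x_mirror) auto
    have "0 < x u - x (mirror k)" "x u < x v"
      using k uv vn by (auto intro!: x_less)
    then have "1 / (x k - x v) - 1 / (x k - x v + (x v - x u))
        \<le> 1 / (x u - x (mirror k)) - 1 / (x u - x (mirror k) + (x v - x u))"
      using xuv xm by (intro inverse_diff_mono) auto
    then show "w v k - w u k \<le> w u (mirror k) - w v (mirror k)"
      using k uv vn by (simp add: w_less w_greater)
  qed
  also have "\<dots> = (\<Sum>k\<in>mirror ` (S \<inter> {v<..n}). w u k - w v k)"
    by (subst sum.reindex) (auto simp: inj_on_def)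
  also have "\<dots> \<le> (\<Sum>k\<in>S \<inter> {1..<u}. w u k - w v k)"
    using fS right S uv vn w_decreasing_left by (intro sum_mono2) force+
  finally show ?thesis
    using gain drift_nonneg[of u v] uv by (simp add: T_def)
qed

section \<open>Symmetries of the cut\<close>

lemma cut_complement:
  assumes "S \<subseteq> {1..n}"
  shows "cut ({1..n} - S) = cut S"
proof -
  have "{1..n} - ({1..n} - S) = S"
    using assms by auto
  then show ?thesis
    unfolding cut_def by (subst sum.swap) (simp add: w_commute)
qed

lemma w_mirror:
  assumes "i \<in> {1..n}" "j \<in> {1..n}"
  shows "w (mirror i) (mirror j) = w i j"
proof -
  have "x (mirror i) = - x i" "x (mirror j) = - x j"
    using assms x_mirror[of i] x_mirror[of j] by auto
  then show ?thesis
    unfolding w_def by (metis abs_minus_commute minus_diff_eq diff_minus_eq_add add.commute uminus_add_conv_diff)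
qed

lemma cut_mirror:
  assumes "S \<subseteq> {1..n}"
  shows "cut (mirror ` S) = cut S"
proof -
  have inj: "inj_on mirror A" if "A \<subseteq> {1..n}" for A
    by (rule inj_on_inverseI[of _ mirror]) (use that in auto)
  have "{1..n} - mirror ` S = mirror ` ({1..n} - S)"
  proof (intro equalityI subsetI)
    fix i assume "i \<in> {1..n} - mirror ` S"
    then have "i = mirror (mirror i)" "mirror i \<in> {1..n} - S"
      by (auto simp: image_iff)
    then show "i \<in> mirror ` ({1..n} - S)"
      by blast
  next
    fix i assume "i \<in> mirror ` ({1..n} - S)"
    then obtain j where j: "j \<in> {1..n} - S" "i = mirror j"
      by auto
    have "mirror j \<noteq> mirror k" if "k \<in> S" for k
      using that j(1) inj_onD[OF inj[of "{1..n}"], of j k] assms by auto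
    then show "i \<in> {1..n} - mirror ` S"
      using j by auto
  qed
  then have "cut (mirror ` S) = (\<Sum>i\<in>mirror ` S. \<Sum>j\<in>mirror ` ({1..n} - S). w i j)"
    by (simp add: cut_def)
  also have "\<dots> = (\<Sum>i\<in>S. \<Sum>j\<in>{1..n} - S. w (mirror i) (mirror j))"
    using assms by (simp only: sum.reindex[OF inj[OF assms]] sum.reindex[OF inj[OF Diff_subset]] comp_def)
  also have "\<dots> = cut S"
    unfolding cut_def using assms by (intro sum.cong refl w_mirror) auto
  finally show ?thesis .
qed

section \<open>Two-point rearrangement under the reflection\<close>

text \<open>This is polarization towards the left half: a mirror pair with one selected index ends
  up with the left one selected, and any other pair is unchanged. The centre of an odd configuration
  stays put.\<close>

definition push :: "nat set \<Rightarrow> nat \<Rightarrow> nat" where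
  "push S i = (if mirror i < i \<and> mirror i \<notin> S then mirror i else i)"

text \<open>Membership after pushing depends only on the mirror pair of \<open>i\<close>, which
  reduces the comparison of cuts to a finite case check on quadruples.\<close>

lemma mem_push_iff:
  assumes "S \<subseteq> {1..n}" "i \<in> {1..n}"
  shows "i \<in> push S ` S \<longleftrightarrow> (i \<in> S \<and> mirror i \<in> S) \<or> (i \<le> mirror i \<and> (i \<in> S \<or> mirror i \<in> S))"
proof
  assume "i \<in> push S ` S"
  then obtain j where "j \<in> S" "i = push S j"
    by blast
  then show "(i \<in> S \<and> mirror i \<in> S) \<or> (i \<le> mirror i \<and> (i \<in> S \<or> mirror i \<in> S))"
    using assms by (force simp: push_def split: if_splits)
next
  assume rhs: "(i \<in> S \<and> mirror i \<in> S) \<or> (i \<le> mirror i \<and> (i \<in> S \<or> mirror i \<in> S))"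
  show "i \<in> push S ` S"
  proof (cases "i \<in> S")
    case True
    then have "push S i = i"
      using rhs by (auto simp: push_def)
    then show ?thesis
      using True by (metis imageI)
  next
    case False
    then have m: "mirror i \<in> S" "i \<le> mirror i"
      using rhs by auto
    then have "i < mirror i"
      using False by (metis le_neq_implies_less)
    then have "push S (mirror i) = i"
      using False assms(2) by (auto simp: push_def)
    then show ?thesis
      using m(1) by (metis imageI)
  qed
qed

lemma push_subset: "S \<subseteq> {1..n} \<Longrightarrow> push S ` S \<subseteq> {1..n}"
  by (auto simp: push_def)

lemma inj_push: "S \<subseteq> {1..n} \<Longrightarrow> inj_on (push S) S"
  by (rule inj_onI) (force simp: push_def split: if_splits)

lemma push_le: "push S i \<le> i"
  by (auto simp: push_def)

text \<open>Summing over all ordered pairs counts every separated pair twice. The full index square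
  is invariant under reflecting either coordinate, which the sum defining \<open>cut\<close> is
  not.\<close>

lemma two_cut:
  assumes "S \<subseteq> {1..n}"
  shows "2 * cut S = (\<Sum>i\<in>{1..n}. \<Sum>j\<in>{1..n}. w i j * of_bool ((i \<in> S) \<noteq> (j \<in> S)))"
proof -
  have *: "(\<Sum>i\<in>A. \<Sum>j\<in>{1..n}. w i j * of_bool ((i \<in> S) \<noteq> (j \<in> S))) = cut A"
    if A: "A = S \<or> A = {1..n} - S" for A
    unfolding cut_def
  proof (rule sum.cong)
    fix i assume "i \<in> A"
    then have "w i j * of_bool ((i \<in> S) \<noteq> (j \<in> S)) = (if j \<in> {1..n} - A then w i j else 0)"
      if "j \<in> {1..n}" for j
      using that A by auto
    then show "(\<Sum>j\<in>{1..n}. w i j * of_bool ((i \<in> S) \<noteq> (j \<in> S))) = (\<Sum>j\<in>{1..n} - A. w i j)"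
      by (subst sum.mono_neutral_right[of "{1..n}" "{1..n} - A"]) (auto intro!: sum.cong)
  qed simp
  have "(\<Sum>i\<in>{1..n}. \<Sum>j\<in>{1..n}. w i j * of_bool ((i \<in> S) \<noteq> (j \<in> S))) = cut ({1..n} - S) + cut S"
    by (subst sum.subset_diff[OF assms]) (simp_all only: finite_atLeastAtMost *[OF disjI1[OF refl]] *[OF disjI2[OF refl]])
  then show ?thesis
    using cut_complement[OF assms] by simp
qed

lemma sum_mirror: "(\<Sum>i\<in>{1..n}. h (mirror i)) = (\<Sum>i\<in>{1..n}. h i)"
  by (rule sum.reindex_bij_witness[of _ mirror mirror]) auto

text \<open>For two points on the nonpositive side, reflecting one of them cannot bring it closer to
  the other. The case \<open>i = j\<close> is excluded because division by zero makes
  \<open>w i i\<close> equal to 0.\<close>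

lemma w_mirror_le:
  assumes "i \<in> {1..n}" "j \<in> {1..n}" "i \<le> mirror i" "j \<le> mirror j" "i \<noteq> j"
  shows "w i (mirror j) \<le> w i j"
proof -
  have "x i \<le> x (mirror i)" "x j \<le> x (mirror j)"
    using assms by (auto intro!: x_le)
  then have "x i \<le> 0" "x j \<le> 0" "x (mirror j) = - x j"
    using assms x_mirror[of i] x_mirror[of j] by auto
  moreover have "x i \<noteq> x j"
    using assms x_less[of i j] x_less[of j i] by (cases i j rule: linorder_cases) auto
  ultimately show ?thesis
    unfolding w_def by (intro divide_left_mono) auto
qed

text \<open>Two-point rearrangement: on every quadruple \<open>i, j, mirror i, mirror j\<close> pushing puts the
  selected points on the same side, where the weights between them are larger.\<close>

lemma cut_push:
  assumes S: "S \<subseteq> {1..n}"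
  shows "cut (push S ` S) \<le> cut S"
proof -
  define c where "c A i j = w i j * of_bool ((i \<in> A) \<noteq> (j \<in> A))" for A i j
  define q where "q A i j = c A i j + c A (mirror i) j + c A i (mirror j) + c A (mirror i) (mirror j)" for A i j
  \<comment> \<open>The factor 8 is 2 for ordered pairs times 4 for the reflected copies collected
    in \<open>q\<close>.\<close>
  have four: "8 * cut A = (\<Sum>i\<in>{1..n}. \<Sum>j\<in>{1..n}. q A i j)" if "A \<subseteq> {1..n}" for A
  proof -
    have "(\<Sum>i\<in>{1..n}. \<Sum>j\<in>{1..n}. c A (mirror i) j) = 2 * cut A"
      using sum_mirror[of "\<lambda>i. \<Sum>j\<in>{1..n}. c A i j"] two_cut[OF that] by (simp add: c_def)
    moreover have "(\<Sum>i\<in>{1..n}. \<Sum>j\<in>{1..n}. c A (mirror i) (mirror j)) = 2 * cut A"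
      using sum_mirror[of "\<lambda>i. \<Sum>j\<in>{1..n}. c A i (mirror j)"] sum_mirror[of "c A i" for i] two_cut[OF that]
      by (simp add: c_def)
    moreover have "(\<Sum>i\<in>{1..n}. \<Sum>j\<in>{1..n}. c A i (mirror j)) = 2 * cut A"
      using sum_mirror[of "c A i" for i] two_cut[OF that] by (simp add: c_def)
    ultimately show ?thesis
      using two_cut[OF that] by (simp add: q_def sum.distrib c_def)
  qed
  have "q (push S ` S) i j \<le> q S i j" if i: "i \<in> {1..n}" and j: "j \<in> {1..n}" for i j
  proof -
    have mem: "mirror i \<in> {1..n}" "mirror j \<in> {1..n}" "mirror (mirror i) = i" "mirror (mirror j) = j"
      using i j by auto
    have w: "w (mirror i) (mirror j) = w i j" "w (mirror i) j = w i (mirror j)"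
      using w_mirror[OF i j] w_mirror[OF i mem(2)] mem(4) by auto
    have near: "i \<le> mirror i \<Longrightarrow> j \<le> mirror j \<Longrightarrow> i \<noteq> j \<Longrightarrow> w i (mirror j) \<le> w i j"
      "mirror i \<le> i \<Longrightarrow> mirror j \<le> j \<Longrightarrow> mirror i \<noteq> mirror j \<Longrightarrow> w i (mirror j) \<le> w i j"
      "i \<le> mirror i \<Longrightarrow> mirror j \<le> j \<Longrightarrow> i \<noteq> mirror j \<Longrightarrow> w i j \<le> w i (mirror j)"
      "mirror i \<le> i \<Longrightarrow> j \<le> mirror j \<Longrightarrow> mirror i \<noteq> j \<Longrightarrow> w i j \<le> w i (mirror j)"
      using w_mirror_le[of i j] w_mirror_le[of "mirror i" "mirror j"]
        w_mirror_le[of i "mirror j"] w_mirror_le[of "mirror i" j]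
      by (simp_all only: i j w mem simp_thms True_implies_equals)
    \<comment> \<open>Reflection invariance leaves only these two weights on a quadruple.\<close>
    define a b where "a = w i j" and "b = w i (mirror j)"
    define I J where "I = mirror i" and "J = mirror j"
    have P: "i \<in> push S ` S \<longleftrightarrow> (i \<in> S \<and> I \<in> S) \<or> (i \<le> I \<and> (i \<in> S \<or> I \<in> S))"
      "I \<in> push S ` S \<longleftrightarrow> (i \<in> S \<and> I \<in> S) \<or> (I \<le> i \<and> (i \<in> S \<or> I \<in> S))"
      "j \<in> push S ` S \<longleftrightarrow> (j \<in> S \<and> J \<in> S) \<or> (j \<le> J \<and> (j \<in> S \<or> J \<in> S))"
      "J \<in> push S ` S \<longleftrightarrow> (j \<in> S \<and> J \<in> S) \<or> (J \<le> j \<and> (j \<in> S \<or> J \<in> S))"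
      using mem_push_iff[OF S i] mem_push_iff[OF S j] mem_push_iff[OF S mem(1)] mem_push_iff[OF S mem(2)]
      unfolding mem I_def J_def by auto
    have q: "q A i j = a * (of_bool ((i \<in> A) \<noteq> (j \<in> A)) + of_bool ((I \<in> A) \<noteq> (J \<in> A)))
        + b * (of_bool ((I \<in> A) \<noteq> (j \<in> A)) + of_bool ((i \<in> A) \<noteq> (J \<in> A)))" for A
      unfolding q_def c_def w a_def b_def I_def J_def by (simp add: algebra_simps)
    have near': "i \<le> I \<Longrightarrow> j \<le> J \<Longrightarrow> i \<noteq> j \<Longrightarrow> b \<le> a"
      "I \<le> i \<Longrightarrow> J \<le> j \<Longrightarrow> I \<noteq> J \<Longrightarrow> b \<le> a"
      "i \<le> I \<Longrightarrow> J \<le> j \<Longrightarrow> i \<noteq> J \<Longrightarrow> a \<le> b"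
      "I \<le> i \<Longrightarrow> j \<le> J \<Longrightarrow> I \<noteq> j \<Longrightarrow> a \<le> b"
      using near by (simp_all add: a_def b_def I_def J_def)
    have eq: "(i = j) = (I = J)" "(i = J) = (I = j)"
      using i j by (auto simp: I_def J_def)
    have same: "i = j \<Longrightarrow> (i \<in> S \<longleftrightarrow> j \<in> S) \<and> (I \<in> S \<longleftrightarrow> J \<in> S)"
      "i = J \<Longrightarrow> (i \<in> S \<longleftrightarrow> J \<in> S) \<and> (I \<in> S \<longleftrightarrow> j \<in> S)"
      using eq by auto
    \<comment> \<open>If an index is its own mirror image, pushing leaves \<open>q\<close>
      unchanged. With both indices in the same half the larger weight is \<open>a\<close>, in
      opposite halves it is \<open>b\<close>; pushing leaves as few pairs of larger weight separated
      as possible. Coinciding indices are handled by \<open>same\<close>.\<close>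
    consider "i = I" | "j = J" | "i < I" "j < J" | "I < i" "J < j" | "i < I" "J < j" | "I < i" "j < J"
      by linarith
    then show ?thesis
    proof cases
      case 1
      then show ?thesis
        unfolding q P by (cases "i \<in> S"; cases "j \<in> S"; cases "J \<in> S"; cases "j \<le> J"; cases "J \<le> j") auto
    next
      case 2
      then show ?thesis
        unfolding q P by (cases "j \<in> S"; cases "i \<in> S"; cases "I \<in> S"; cases "i \<le> I"; cases "I \<le> i") auto
    next
      case 3
      then have "i = j \<or> b \<le> a"
        using near'(1) by auto
      then show ?thesis
        unfolding q P using 3 same(1) by (cases "i \<in> S"; cases "I \<in> S"; cases "j \<in> S"; cases "J \<in> S") auto
    next
      case 4
      then have "i = j \<or> b \<le> a"
        using near'(2) eq by auto
      then show ?thesis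
        unfolding q P using 4 same(1) by (cases "i \<in> S"; cases "I \<in> S"; cases "j \<in> S"; cases "J \<in> S") auto
    next
      case 5
      then have "i = J \<or> a \<le> b"
        using near'(3) by auto
      then show ?thesis
        unfolding q P using 5 same(2) by (cases "i \<in> S"; cases "I \<in> S"; cases "j \<in> S"; cases "J \<in> S") auto
    next
      case 6
      then have "i = J \<or> a \<le> b"
        using near'(4) eq by auto
      then show ?thesis
        unfolding q P using 6 same(2) by (cases "i \<in> S"; cases "I \<in> S"; cases "j \<in> S"; cases "J \<in> S") auto
    qed
  qed
  then have "8 * cut (push S ` S) \<le> 8 * cut S"
    unfolding four[OF S] four[OF push_subset[OF S]] by (intro sum_mono)
  then show ?thesis
    by simp
qed

lemma push_fixed_imp:
  assumes "S \<subseteq> {1..n}" "push S ` S = S" "i \<in> S" "mirror i \<le> i"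
  shows "mirror i \<in> S"
proof -
  have "i \<in> {1..n}"
    using assms by auto
  then have "mirror i \<in> {1..n}" "mirror (mirror i) = i"
    by auto
  then show ?thesis
    using mem_push_iff[OF assms(1), of "mirror i"] assms by auto
qed

section \<open>Descent to an initial segment\<close>

lemma cut_ge_initial:
  assumes "S \<subseteq> {1..n}"
  shows "cut {1..card S} \<le> cut S"
  using assms
proof (induction "\<Sum>S" arbitrary: S rule: less_induct)
  case less
  note S = \<open>S \<subseteq> {1..n}\<close>
  have fS: "finite S"
    using S finite_subset by blast
  \<comment> \<open>Exchanging a selected index for a smaller unselected one keeps the cardinality
    and lowers the sum, so the induction hypothesis applies.\<close>
  have step: "cut {1..card S} \<le> cut S"
    if "insert u (S - {v}) \<subseteq> {1..n}" "v \<in> S" "u \<notin> S" "u < v" "cut (insert u (S - {v})) \<le> cut S" for u v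
  proof -
    have "card (insert u (S - {v})) = card S"
      using that fS by (simp add: card_Suc_Diff1 del: card_Diff_insert)
    moreover have "\<Sum>(insert u (S - {v})) < \<Sum>S"
      using that fS by (simp add: sum.remove)
    ultimately show ?thesis
      using less.hyps[of "insert u (S - {v})"] that by simp
  qed
  show ?case
  proof (cases "push S ` S = S")
    case False
    then obtain i where i: "i \<in> S" "push S i \<noteq> i"
      by (metis image_cong image_ident)
    have "\<Sum>(push S ` S) = (\<Sum>i\<in>S. push S i)"
      using inj_push[OF S] by (simp add: sum.reindex)
    also have "\<dots> < \<Sum>S"
      using i fS push_le[of S] by (intro sum_strict_mono_ex1) (auto intro!: bexI[of _ i] simp: le_neq_implies_less)
    finally have "cut {1..card (push S ` S)} \<le> cut (push S ` S)"
      by (rule less.hyps) (rule push_subset[OF S])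
    then show ?thesis
      using card_image[OF inj_push[OF S]] cut_push[OF S] by simp
  next
    case True
    note heavy = push_fixed_imp[OF S True]
    \<comment> \<open>The contrapositive of \<open>heavy\<close>, used for the complement of
      \<open>S\<close>.\<close>
    have heavy': "mirror i \<notin> S" if "i \<in> {1..n}" "i \<notin> S" "i \<le> mirror i" for i
      using heavy[of "mirror i"] that by auto
    show ?thesis
    proof (cases "S = {}")
      case False
      \<comment> \<open>For odd \<open>n\<close> the centre is \<open>h\<close> itself and belongs
        to the left half.\<close>
      define h where "h = (n + 1) div 2"
      define L where "L = S \<inter> {1..h}"
      have half: "i \<le> h \<longleftrightarrow> i \<le> mirror i" if "i \<in> {1..n}" for i
        using that by (auto simp: h_def)
      have half': "h < i \<Longrightarrow> mirror i \<le> i" if "i \<in> {1..n}" for i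
        using that unfolding h_def by auto
      obtain i where "i \<in> S"
        using False by auto
      then have "i \<in> L \<or> mirror i \<in> L"
        using heavy[of i] half[of i] half[of "mirror i"] S by (auto simp: L_def subset_iff)
      moreover have "finite L"
        by (simp add: L_def)
      ultimately have b: "Max L \<in> L" and b_max: "\<And>k. k \<in> L \<Longrightarrow> k \<le> Max L"
        by (metis Max_in empty_iff, metis Max_ge)
      define b where "b = Max L"
      have bL: "b \<in> S" "b \<le> h" "1 \<le> b" "b \<le> n"
        using b S by (auto simp: b_def L_def)
      have b_last: "k \<le> b" if "k \<in> S" "k \<le> h" for k
        using b_max[of k] that S by (auto simp: b_def L_def)
      \<comment> \<open>\<open>{u<..v}\<close> will be the maximal run of selected indices through
        \<open>b\<close>. Its right end may lie beyond the centre.\<close>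
      define v where "v = (GREATEST v. b \<le> v \<and> {b..v} \<subseteq> S)"
      have v: "b \<le> v" "{b..v} \<subseteq> S" and v_max: "\<And>k. b \<le> k \<Longrightarrow> {b..k} \<subseteq> S \<Longrightarrow> k \<le> v"
      proof -
        have bd: "\<forall>y. b \<le> y \<and> {b..y} \<subseteq> S \<longrightarrow> y \<le> n"
          using S by (auto simp: subset_iff)
        have ex: "b \<le> b \<and> {b..b} \<subseteq> S"
          using bL by auto
        show "b \<le> v" "{b..v} \<subseteq> S"
          using GreatestI_nat[of "\<lambda>v. b \<le> v \<and> {b..v} \<subseteq> S", OF ex] bd unfolding v_def by blast+
        show "k \<le> v" if "b \<le> k" "{b..k} \<subseteq> S" for k
          using Greatest_le_nat[of "\<lambda>v. b \<le> v \<and> {b..v} \<subseteq> S" k n] that bd unfolding v_def by blast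
      qed
      have v_notin: "Suc v \<notin> S"
      proof
        assume "Suc v \<in> S"
        then have "{b..Suc v} \<subseteq> S"
          using v by (auto simp: le_Suc_eq subset_iff)
        then show False
          using v_max[of "Suc v"] v(1) by auto
      qed
      \<comment> \<open>\<open>u = 0\<close> occurs exactly when the run starts at index 1.\<close>
      define u where "u = (LEAST u. {u<..b} \<subseteq> S)"
      have u: "{u<..b} \<subseteq> S" and u_min: "\<And>k. {k<..b} \<subseteq> S \<Longrightarrow> u \<le> k"
        using LeastI[of "\<lambda>u. {u<..b} \<subseteq> S" b] Least_le[of "\<lambda>u. {u<..b} \<subseteq> S"] unfolding u_def by auto
      have "{b - 1<..b} = {b}"
        using bL by auto
      then have ub: "u < b"
        using u_min[of "b - 1"] bL by simp
      have u_notin: "u \<notin> S"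
      proof
        assume "u \<in> S"
        then have "1 \<le> u"
          using S by auto
        moreover have "{u - 1<..b} \<subseteq> S"
        proof
          fix k assume "k \<in> {u - 1<..b}"
          then have "k = u \<or> k \<in> {u<..b}"
            by auto
          then show "k \<in> S"
            using u \<open>u \<in> S\<close> by auto
        qed
        ultimately show False
          using u_min[of "u - 1"] by auto
      qed
      have block: "{u<..v} \<subseteq> S"
      proof
        fix k assume "k \<in> {u<..v}"
        then show "k \<in> S"
          using u v by (cases "k \<le> b") auto
      qed
      have "v \<in> S"
        using v by auto
      then have vS: "v \<in> S" "v \<le> n"
        using S by auto
      have right_half: "h < k" if "k \<in> S" "v < k" for k
        using b_last[of k] that v(1) by (cases "k \<le> h") auto
      show ?thesis
      \<comment> \<open>If no such \<open>c\<close> exists, every selected index beyond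
        \<open>v\<close> has its mirror image left of \<open>u\<close>, as \<open>cut_shift\<close>
        demands, and the block moves left. Otherwise the unselected gap after the block moves
        right.\<close>
      proof (cases "\<exists>c\<in>S. v < c \<and> u \<le> mirror c")
        case False
        show ?thesis
        proof (cases "u = 0")
          case True
          \<comment> \<open>With \<open>u = 0\<close> the condition \<open>u \<le> mirror c\<close>
            always holds, so nothing selected lies beyond \<open>v\<close>.\<close>
          have "S = {1..v}"
          proof
            show "S \<subseteq> {1..v}"
              using False S True by (auto simp: subset_iff not_less)
          qed (use block True in auto)
          then show ?thesis
            by simp
        next
          case u0: False
          have mu: "mirror u \<notin> S"
            using heavy'[of u] u_notin ub bL u0 half[of u] by auto
          \<comment> \<open>Otherwise the block would contain \<open>mirror u\<close>, which is
            unselected because \<open>u\<close> is an unselected index of the left half.\<close>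
          have "u + v \<le> n + 1"
          proof (rule ccontr)
            assume "\<not> u + v \<le> n + 1"
            then have "mirror u \<in> {u<..v}"
              using ub bL h_def by auto
            then show False
              using mu block by blast
          qed
          moreover have "mirror k \<in> S \<and> mirror k < u" if "k \<in> S" "v < k" for k
            using that False heavy[of k] right_half[of k] half[of k] half'[of k] S
            by (auto simp: not_le)
          ultimately have "cut (insert u (S - {v})) \<le> cut S"
            using S u0 ub v(1) u_notin block by (intro cut_shift) auto
          then show ?thesis
            using S u0 ub v(1) u_notin vS bL by (intro step[of u v]) auto
        qed
      next
        case True
        define c where "c = (LEAST c. c \<in> S \<and> v < c)"
        have c: "c \<in> S" "v < c" and c_min: "\<And>k. k \<in> S \<Longrightarrow> v < k \<Longrightarrow> c \<le> k"
        proof -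
          obtain c0 where "c0 \<in> S \<and> v < c0"
            using True by auto
          then show "c \<in> S" "v < c"
            using LeastI[of "\<lambda>c. c \<in> S \<and> v < c" c0] unfolding c_def by auto
          show "c \<le> k" if "k \<in> S" "v < k" for k
            unfolding c_def using that by (intro Least_le) auto
        qed
        have cn: "c \<in> {1..n}"
          using c S by auto
        have mc: "mirror c \<in> S"
          using heavy[of c] c right_half[of c] half'[OF cn] by auto
        \<comment> \<open>Reflection reverses order, so the least candidate \<open>c\<close>
          inherits the bound from any other.\<close>
        have "u \<le> mirror c"
          using True c_min by force
        then have umc: "u < mirror c"
          using mc u_notin by (metis le_neq_implies_less)
        have vc: "Suc v < c"
          using c v_notin by (metis Suc_lessI)
        have gap: "k \<notin> S" if "v < k" "k < c" for k
          using c_min[of k] that by auto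
        have "mirror c \<le> h"
          using half[of "mirror c"] right_half[OF c] half'[OF cn] cn by auto
        then have mcv: "mirror c \<le> v"
          using b_last[OF mc] v(1) by simp
        let ?T = "insert (Suc v) (S - {c})"
        \<comment> \<open>In the mirrored complement the gap \<open>{v<..<c}\<close> becomes the
          selected block \<open>{mirror c<..mirror (Suc v)}\<close>. Moving that block left amounts
          to replacing \<open>c\<close> by \<open>Suc v\<close> in \<open>S\<close>.\<close>
        let ?R = "mirror ` ({1..n} - S)"
        have R_iff: "k \<in> ?R \<longleftrightarrow> mirror k \<notin> S" if "k \<in> {1..n}" for k
        proof
          assume "k \<in> ?R"
          then show "mirror k \<notin> S"
            by auto
        next
          assume "mirror k \<notin> S"
          then have "mirror k \<in> {1..n} - S" "k = mirror (mirror k)"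
            using that by auto
          then show "k \<in> ?R"
            by blast
        qed
        have T: "?T \<subseteq> {1..n}"
          using S vc cn by auto
        have "cut (insert (mirror c) (?R - {mirror (Suc v)})) \<le> cut ?R"
        proof (rule cut_shift)
          show "?R \<subseteq> {1..n}"
            by auto
          show "mirror c + mirror (Suc v) \<le> n + 1"
            using mcv by simp
          show "mirror c \<notin> ?R"
          proof -
            have "mirror c \<in> {1..n}" "mirror (mirror c) = c"
              using cn by auto
            then show ?thesis
              using R_iff c by metis
          qed
          show "{mirror c<..mirror (Suc v)} \<subseteq> ?R"
          proof
            fix k assume k: "k \<in> {mirror c<..mirror (Suc v)}"
            then have "k \<in> {1..n}" "v < mirror k" "mirror k < c"
              using cn by auto
            then show "k \<in> ?R"
              using R_iff gap by blast
          qed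
          show "mirror k \<in> ?R \<and> mirror k < mirror c" if k: "k \<in> ?R" "mirror (Suc v) < k" for k
          proof -
            have kn: "k \<in> {1..n}"
              using k by auto
            have "mirror k \<notin> S"
              using k R_iff kn by blast
            moreover have "mirror k \<le> v"
              using k kn by auto
            \<comment> \<open>An unselected index up to \<open>v\<close> cannot lie in the run
              \<open>{u<..v}\<close>. It is therefore in the left half, and \<open>heavy'\<close>
              supplies its unselected mirror image.\<close>
            ultimately have "mirror k \<le> u"
              using block by (meson greaterThanAtMost_iff not_le subsetD)
            then have "mirror k \<le> h" "mirror k < mirror c"
              using ub bL umc by auto
            moreover have mk: "mirror k \<in> {1..n}"
              using kn by auto
            moreover have "mirror (mirror k) \<notin> S"
              using heavy'[OF mk \<open>mirror k \<notin> S\<close>] half[OF mk] \<open>mirror k \<le> h\<close> by blast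
            ultimately show ?thesis
              using R_iff by blast
          qed
        qed (use cn vc in auto)
        also have "insert (mirror c) (?R - {mirror (Suc v)}) = mirror ` ({1..n} - ?T)"
        proof -
          have "{1..n} - ?T = insert c (({1..n} - S) - {Suc v})"
            using cn c vc by auto
          moreover have "mirror ` (({1..n} - S) - {Suc v}) = ?R - {mirror (Suc v)}"
            using vc cn by (subst inj_on_image_set_diff[of _ "{1..n}"]) (auto simp: inj_on_def)
          ultimately show ?thesis
            by simp
        qed
        finally have "cut ?T \<le> cut S"
          using cut_mirror[of "{1..n} - ?T"] cut_mirror[of "{1..n} - S"] cut_complement[OF T] cut_complement[OF S]
          by simp
        then show ?thesis
          using T c v_notin vc by (intro step[of "Suc v" c]) auto
      qed
    qed (simp add: cut_def)
  qed
qed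

end

section \<open>Zeros of the Hermite polynomials\<close>

text \<open>The vanishing of higher coefficients is part of the induction: it removes the
  \<open>hermite n\<close> term from the top coefficient in the recurrence.\<close>

lemma hermite_coeff: "coeff (hermite n) n = 2 ^ n \<and> (\<forall>k>n. coeff (hermite n) k = 0)"
proof (induction n rule: hermite.induct)
  case 2
  then show ?case
    by (auto simp: coeff_pCons split: nat.splits)
next
  case (3 n)
  then show ?case
    by (auto simp: coeff_pCons split: nat.splits)
qed auto

lemma degree_hermite [simp]: "degree (hermite n) = n"
  using hermite_coeff[of n] by (intro antisym degree_le le_degree) auto

lemma hermite_nonzero [simp]: "hermite n \<noteq> 0"
  using hermite_coeff[of n] by auto

lemma pderiv_hermite:
  "poly (pderiv (hermite (Suc n))) t = 2 * real (Suc n) * poly (hermite n) t"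
proof (induction n rule: hermite.induct)
  case (3 n)
  have rec: "poly (hermite (Suc (Suc n))) t = 2 * t * poly (hermite (Suc n)) t - 2 * real (Suc n) * poly (hermite n) t"
    by simp
  have "poly (pderiv (hermite (Suc (Suc (Suc n))))) t
      = 2 * poly (hermite (Suc (Suc n))) t + 2 * t * poly (pderiv (hermite (Suc (Suc n)))) t
        - 2 * real (Suc (Suc n)) * poly (pderiv (hermite (Suc n))) t"
    by (subst hermite.simps(3))
      (simp add: pderiv_diff pderiv_mult pderiv_smult pderiv_pCons del: mult_pCons_left hermite.simps)
  also have "\<dots> = 2 * poly (hermite (Suc (Suc n))) t + 2 * real (Suc (Suc n)) * poly (hermite (Suc (Suc n))) t"
    unfolding 3 rec by (simp add: algebra_simps)
  finally show ?case
    by (simp add: algebra_simps del: hermite.simps)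
qed (auto simp: pderiv_diff pderiv_mult pderiv_smult pderiv_pCons algebra_simps)

lemma hermite_Suc_eq_pderiv:
  "poly (hermite (Suc n)) t = 2 * t * poly (hermite n) t - poly (pderiv (hermite n)) t"
  by (cases n) (simp_all add: pderiv_hermite algebra_simps)

text \<open>Differentiate \<open>hermite_Suc_eq_pderiv\<close> and replace the derivative on the
  left by \<open>pderiv_hermite\<close>.\<close>

lemma hermite_ode:
  "poly (pderiv (pderiv (hermite n))) t
    = 2 * t * poly (pderiv (hermite n)) t - 2 * real n * poly (hermite n) t"
proof -
  have "hermite (Suc n) = [:0, 2:] * hermite n - pderiv (hermite n)"
    unfolding poly_eq_poly_eq_iff [symmetric]
    by (rule ext) (use hermite_Suc_eq_pderiv[of n] in \<open>simp del: mult_pCons_left hermite.simps\<close>)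
  then have "poly (pderiv (hermite (Suc n))) t = poly (pderiv ([:0, 2:] * hermite n - pderiv (hermite n))) t"
    by simp
  then show ?thesis
    unfolding pderiv_hermite by (simp add: pderiv_diff pderiv_mult pderiv_pCons pderiv_smult algebra_simps)
qed

lemma hermite_uminus: "poly (hermite n) (- t) = (- 1) ^ n * poly (hermite n) t"
  by (induction n rule: hermite.induct) (simp_all add: algebra_simps)

definition hermite_zeros :: "nat \<Rightarrow> real set" where
  "hermite_zeros n = {t. poly (hermite n) t = 0}"

lemma finite_hermite_zeros [simp]: "finite (hermite_zeros n)"
  by (simp add: hermite_zeros_def poly_roots_finite)

lemma uminus_hermite_zeros: "t \<in> hermite_zeros n \<Longrightarrow> - t \<in> hermite_zeros n"
  by (simp add: hermite_zeros_def hermite_uminus)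

section \<open>Polynomials with simple real roots\<close>

text \<open>Both sides have the same leading coefficient and agree at as many points as the
  degree.\<close>

lemma poly_eq_prod_roots:
  fixes p :: "real poly"
  assumes "card {t. poly p t = 0} = degree p" "p \<noteq> 0"
  shows "p = smult (lead_coeff p) (\<Prod>a\<in>{t. poly p t = 0}. [:- a, 1:])"
proof (rule poly_eqI_degree_lead_coeff[where n = "degree p" and A = "{t. poly p t = 0}"])
  let ?A = "{t. poly p t = 0}"
  let ?r = "\<Prod>a\<in>?A. [:- a, 1:]"
  have fin: "finite ?A"
    using assms by (simp add: poly_roots_finite)
  have d: "degree ?r = degree p"
    using assms(1) by (simp add: degree_prod_eq_sum_degree)
  have "lead_coeff ?r = 1"
    by (simp add: lead_coeff_prod)
  then have "coeff ?r (degree p) = 1"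
    using d by simp
  then show "coeff p (degree p) = coeff (smult (lead_coeff p) ?r) (degree p)"
    by simp
  show "degree (smult (lead_coeff p) ?r) \<le> degree p"
    using d assms by simp
  show "degree p \<le> card ?A"
    using assms by simp
  show "poly p t = poly (smult (lead_coeff p) ?r) t" if "t \<in> ?A" for t
  proof -
    have "poly ?r t = 0"
      using that fin by (auto simp: poly_prod intro!: prod_zero)
    then show ?thesis
      using that by simp
  qed
qed auto

text \<open>The logarithmic derivative of \<open>p / (t - a)\<close> at the simple root \<open>a\<close>.\<close>

lemma pderiv2_at_simple_root:
  fixes p :: "real poly"
  assumes p: "p = smult c (\<Prod>a\<in>A. [:- a, 1:])" and A: "finite A" "a \<in> A" and c: "c \<noteq> 0"
  shows "poly (pderiv p) a \<noteq> 0"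
    and "poly (pderiv (pderiv p)) a = 2 * poly (pderiv p) a * (\<Sum>b\<in>A - {a}. 1 / (a - b))"
proof -
  define r where "r = smult c (\<Prod>b\<in>A - {a}. [:- b, 1:])"
  have pr: "p = [:- a, 1:] * r"
    unfolding p r_def using A by (simp add: prod.remove[of A a])
  have d1: "poly (pderiv p) a = poly r a"
    unfolding pr by (simp add: pderiv_mult pderiv_pCons del: mult_pCons_left)
  have d2: "poly (pderiv (pderiv p)) a = 2 * poly (pderiv r) a"
    unfolding pr by (simp add: pderiv_mult pderiv_pCons pderiv_add del: mult_pCons_left)
  show "poly (pderiv p) a \<noteq> 0"
    unfolding d1 r_def using A c by (simp add: poly_prod)
  have "poly (pderiv r) a = c * (\<Sum>b\<in>A - {a}. \<Prod>d\<in>A - {a} - {b}. a - d)"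
    unfolding r_def by (simp add: pderiv_smult pderiv_prod poly_sum poly_prod pderiv_pCons)
  also have "\<dots> = c * (\<Sum>b\<in>A - {a}. (\<Prod>d\<in>A - {a}. a - d) * (1 / (a - b)))"
  proof (intro arg_cong2[where f = "(*)"] sum.cong refl)
    fix b assume b: "b \<in> A - {a}"
    then show "(\<Prod>d\<in>A - {a} - {b}. a - d) = (\<Prod>d\<in>A - {a}. a - d) * (1 / (a - b))"
      using A by (subst prod.remove[OF _ b]) auto
  qed
  also have "\<dots> = poly r a * (\<Sum>b\<in>A - {a}. 1 / (a - b))"
    by (simp add: r_def poly_prod sum_distrib_left)
  finally show "poly (pderiv (pderiv p)) a = 2 * poly (pderiv p) a * (\<Sum>b\<in>A - {a}. 1 / (a - b))"
    unfolding d1 d2 by simp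
qed

lemma hermite_eq_prod:
  assumes "card (hermite_zeros n) = n"
  shows "hermite n = smult (2 ^ n) (\<Prod>a\<in>hermite_zeros n. [:- a, 1:])"
  using poly_eq_prod_roots[of "hermite n"] assms hermite_coeff[of n] by (simp add: hermite_zeros_def)

section \<open>Counting the zeros\<close>

lemma hermite_pos_at_infinity: "\<exists>M. \<forall>t\<ge>M. 0 < poly (hermite n) t"
proof -
  have "lead_coeff (hermite n) > 0"
    using hermite_coeff[of n] by simp
  then show ?thesis
    using poly_pinfty_gt_lc[of "hermite n"] by (meson less_le_trans)
qed

text \<open>Rolle's theorem for \<open>exp (- t\<^sup>2) * poly (hermite n) t\<close>, whose
  derivative is \<open>- exp (- t\<^sup>2) * poly (hermite (Suc n)) t\<close>.\<close>

lemma hermite_root_between: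
  assumes "a \<in> hermite_zeros n" "b \<in> hermite_zeros n" "a < b"
  obtains t where "a < t" "t < b" "t \<in> hermite_zeros (Suc n)"
proof -
  define f where "f t = exp (- t\<^sup>2) * poly (hermite n) t" for t
  have D: "(f has_real_derivative - (exp (- t\<^sup>2) * poly (hermite (Suc n)) t)) (at t)" for t
    unfolding f_def hermite_Suc_eq_pderiv
    by (auto intro!: derivative_eq_intros simp: algebra_simps power2_eq_square)
  have "f a = f b"
    using assms by (simp add: f_def hermite_zeros_def)
  moreover have "continuous_on {a..b} f"
    using D by (intro continuous_at_imp_continuous_on) (blast intro: DERIV_isCont)
  ultimately obtain z where "a < z" "z < b" "(f has_real_derivative 0) (at z)"
    using Rolle[of a b f] \<open>a < b\<close> D by (metis real_differentiable_def)
  moreover from this have "poly (hermite (Suc n)) z = 0"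
    by (auto dest: DERIV_unique[OF D])
  ultimately show ?thesis
    using that by (auto simp: hermite_zeros_def)
qed

text \<open>At the largest zero the derivative is positive, since otherwise another zero would
  follow. Hence \<open>hermite (Suc n)\<close> is negative there, while it is positive at
  infinity.\<close>

lemma hermite_root_above:
  assumes card: "card (hermite_zeros n) = n" and b: "b \<in> hermite_zeros n"
    and max: "\<And>a. a \<in> hermite_zeros n \<Longrightarrow> a \<le> b"
  obtains t where "b < t" "t \<in> hermite_zeros (Suc n)"
proof -
  let ?p' = "poly (pderiv (hermite n))"
  have D: "(poly (hermite n) has_real_derivative ?p' b) (at b)"
    by (rule poly_DERIV)
  have "?p' b \<noteq> 0"
    by (rule pderiv2_at_simple_root(1)[OF hermite_eq_prod[OF card] _ b]) auto
  moreover have "\<not> ?p' b < 0"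
  proof
    assume "?p' b < 0"
    then obtain d where "d > 0" "\<And>h. 0 < h \<Longrightarrow> h < d \<Longrightarrow> poly (hermite n) (b + h) < poly (hermite n) b"
      using DERIV_neg_dec_right[OF D] by blast
    then have neg: "poly (hermite n) (b + d / 2) < 0"
      using b by (simp add: hermite_zeros_def)
    obtain M where "\<forall>t\<ge>M. 0 < poly (hermite n) t"
      using hermite_pos_at_infinity by blast
    then have "0 < poly (hermite n) (Orderings.max M (b + d))"
      by simp
    then obtain t where "b + d / 2 < t" "poly (hermite n) t = 0"
      using poly_IVT_pos[of "b + d / 2" "Orderings.max M (b + d)" "hermite n"] neg \<open>d > 0\<close> by fastforce
    then show False
      using max[of t] \<open>d > 0\<close> by (auto simp: hermite_zeros_def)
  qed
  ultimately have "poly (hermite (Suc n)) b < 0"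
    using b unfolding hermite_Suc_eq_pderiv by (simp add: hermite_zeros_def)
  moreover obtain M where "\<forall>t\<ge>M. 0 < poly (hermite (Suc n)) t"
    using hermite_pos_at_infinity by blast
  then have "0 < poly (hermite (Suc n)) (Orderings.max M (b + 1))"
    by simp
  moreover have "b < Orderings.max M (b + 1)"
    by linarith
  ultimately obtain t where "b < t" "poly (hermite (Suc n)) t = 0"
    using poly_IVT_pos by blast
  then show ?thesis
    using that by (simp add: hermite_zeros_def)
qed

text \<open>Each zero of \<open>hermite n\<close> is followed by a zero of
  \<open>hermite (Suc n)\<close> before the next one, and by symmetry one more lies below them all.
  The degree gives the upper bound.\<close>

lemma card_hermite_zeros: "card (hermite_zeros n) = n"
proof (induction n)
  case 0
  then show ?case
    by (simp add: hermite_zeros_def)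
next
  case (Suc n)
  let ?Z = "hermite_zeros n" and ?Y = "hermite_zeros (Suc n)"
  have upper: "card ?Y \<le> Suc n"
    using card_poly_roots_bound[OF hermite_nonzero[of "Suc n"]] unfolding hermite_zeros_def degree_hermite .
  show ?case
  proof (cases "n = 0")
    case True
    then show ?thesis
      by (simp add: hermite_zeros_def)
  next
    case False
    then have Z: "?Z \<noteq> {}"
      using Suc by auto
    have above: "\<exists>t\<in>?Y. a < t \<and> (\<forall>z\<in>?Z. a < z \<longrightarrow> t < z)" if a: "a \<in> ?Z" for a
    proof (cases "\<exists>z\<in>?Z. a < z")
      case True
      define b where "b = Min {z \<in> ?Z. a < z}"
      have fin: "finite {z \<in> ?Z. a < z}" and ne: "{z \<in> ?Z. a < z} \<noteq> {}"
        using True by auto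
      have b: "b \<in> ?Z" "a < b" and least: "\<And>z. z \<in> ?Z \<Longrightarrow> a < z \<Longrightarrow> b \<le> z"
        using Min_in[OF fin ne] Min_le[OF fin] unfolding b_def by blast+
      obtain t where "a < t" "t < b" "t \<in> ?Y"
        using hermite_root_between[OF a b] .
      then show ?thesis
        using least by (intro bexI[of _ t]) (auto intro: less_le_trans)
    next
      case False
      then obtain t where "a < t" "t \<in> ?Y"
        using hermite_root_above[OF Suc a] not_le by blast
      then show ?thesis
        using False by blast
    qed
    then have "\<forall>a\<in>?Z. \<exists>t. t \<in> ?Y \<and> a < t \<and> (\<forall>z\<in>?Z. a < z \<longrightarrow> t < z)"
      by blast
    then obtain g where "\<forall>a\<in>?Z. g a \<in> ?Y \<and> a < g a \<and> (\<forall>z\<in>?Z. a < z \<longrightarrow> g a < z)"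
      by (rule bchoice[THEN exE])
    then have g: "\<And>a. a \<in> ?Z \<Longrightarrow> g a \<in> ?Y" "\<And>a. a \<in> ?Z \<Longrightarrow> a < g a"
      "\<And>a z. a \<in> ?Z \<Longrightarrow> z \<in> ?Z \<Longrightarrow> a < z \<Longrightarrow> g a < z"
      by blast+
    have "inj_on g ?Z"
    proof (rule linorder_inj_onI)
      show "g a \<noteq> g b" if "a < b" "a \<in> ?Z" "b \<in> ?Z" for a b
        using g(3)[of a b] g(2)[of b] that by linarith
    qed auto
    then have card_g: "card (g ` ?Z) = n"
      using Suc by (simp add: card_image)
    have max: "Max ?Z \<in> ?Z" "\<And>a. a \<in> ?Z \<Longrightarrow> a \<le> Max ?Z"
      using Z by auto
    then obtain t where t: "Max ?Z < t" "t \<in> ?Y"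
      using hermite_root_above[OF Suc] by blast
    \<comment> \<open>\<open>- a\<close> is also a zero, so \<open>- a \<le> Max ?Z < t\<close>,
      that is, \<open>- t < a\<close>.\<close>
    have below: "- t < g a" if "a \<in> ?Z" for a
      using max(2)[OF uminus_hermite_zeros[OF that]] t(1) g(2)[OF that] by linarith
    have "- t \<notin> g ` ?Z"
    proof
      assume "- t \<in> g ` ?Z"
      then obtain a where a: "- t = g a" "a \<in> ?Z"
        by (rule imageE)
      then show False
        using below[OF a(2)] by simp
    qed
    then have "Suc n = card (insert (- t) (g ` ?Z))"
      using card_g by simp
    also have "\<dots> \<le> card ?Y"
      using g(1) uminus_hermite_zeros[OF t(2)] by (intro card_mono) auto
    finally show ?thesis
      using upper by simp
  qed
qed

lemma pderiv_hermite_root_nonzero: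
  "a \<in> hermite_zeros n \<Longrightarrow> poly (pderiv (hermite n)) a \<noteq> 0"
  by (rule pderiv2_at_simple_root(1)[OF hermite_eq_prod[OF card_hermite_zeros]]) auto

text \<open>At a zero the differential equation reads \<open>H'' = 2 * a * H'\<close>; comparing
  with the root formula for \<open>H''\<close> and cancelling \<open>2 * H'\<close> leaves the
  claim.\<close>

lemma hermite_zeros_balance:
  assumes a: "a \<in> hermite_zeros n"
  shows "(\<Sum>b\<in>hermite_zeros n - {a}. 1 / (a - b)) = a"
proof -
  have "poly (pderiv (pderiv (hermite n))) a
      = 2 * poly (pderiv (hermite n)) a * (\<Sum>b\<in>hermite_zeros n - {a}. 1 / (a - b))"
    by (rule pderiv2_at_simple_root(2)[OF hermite_eq_prod[OF card_hermite_zeros] _ a]) auto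
  then show ?thesis
    using pderiv_hermite_root_nonzero[OF a] a unfolding hermite_ode by (simp add: hermite_zeros_def)
qed

section \<open>Monotonicity of the gaps by Sturm comparison\<close>

text \<open>Sturm comparison of \<open>y (c + t)\<close> with its reflection \<open>- y (c - t)\<close>: their Wronskian starts
  at zero and is decreasing.\<close>

lemma sturm_reflection:
  fixes y y' q :: "real \<Rightarrow> real"
  assumes D1: "\<And>t. (y has_real_derivative y' t) (at t)"
    and D2: "\<And>t. (y' has_real_derivative - q t * y t) (at t)"
    and ac: "a < c" "y a = 0" "y c = 0" "y' a \<noteq> 0"
    and left: "\<And>t. a < t \<Longrightarrow> t < c \<Longrightarrow> y t < 0"
    and right: "\<And>t. c < t \<Longrightarrow> t \<le> 2 * c - a \<Longrightarrow> 0 < y t"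
    and q: "\<And>t. 0 \<le> t \<Longrightarrow> q (c - t) \<le> q (c + t)"
  shows False
proof -
  define W where "W t = - (y' (c + t) * y (c - t) + y (c + t) * y' (c - t))" for t
  have shift: "((\<lambda>t. c + t) has_real_derivative 1) (at t)" "((\<lambda>t. c - t) has_real_derivative - 1) (at t)" for t
    by (auto intro!: derivative_eq_intros)
  note D' = DERIV_chain2[OF D1 shift(1)] DERIV_chain2[OF D1 shift(2)]
    DERIV_chain2[OF D2 shift(1)] DERIV_chain2[OF D2 shift(2)]
  have DW: "(W has_real_derivative (q (c + t) - q (c - t)) * (y (c + t) * y (c - t))) (at t)" for t
    unfolding W_def
    by (rule DERIV_cong[OF DERIV_minus[OF DERIV_add[OF DERIV_mult[OF D'(3,2)] DERIV_mult[OF D'(1,4)]]]])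
      (simp add: algebra_simps)
  have "W (c - a) \<le> W 0"
  proof (rule DERIV_nonpos_imp_nonincreasing[where f = W])
    fix t assume t: "0 \<le> t" "t \<le> c - a"
    have "y (c + t) * y (c - t) \<le> 0"
    proof (cases "t = 0 \<or> t = c - a")
      case False
      then show ?thesis
        using left[of "c - t"] right[of "c + t"] t by (simp add: mult_nonneg_nonpos)
    qed (use ac in auto)
    then have "(q (c + t) - q (c - t)) * (y (c + t) * y (c - t)) \<le> 0"
      using q[OF t(1)] by (simp add: mult_nonneg_nonpos)
    then show "\<exists>z. (W has_real_derivative z) (at t) \<and> z \<le> 0"
      using DW by blast
  qed (use ac in auto)
  \<comment> \<open>\<open>W 0 = 0\<close> because \<open>y c = 0\<close>, and
    \<open>W (c - a) = - y (2 * c - a) * y' a\<close> because \<open>y a = 0\<close>. So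
    \<open>y' a\<close> must be positive, against the negativity of \<open>y\<close> just right of
    \<open>a\<close>.\<close>
  then have "0 \<le> y (2 * c - a) * y' a"
    using ac by (simp add: W_def algebra_simps)
  moreover have "0 < y (2 * c - a)"
    using ac by (intro right) auto
  ultimately have "0 < y' a"
    using ac by (simp add: zero_le_mult_iff)
  then obtain d where d: "d > 0" "\<And>h. 0 < h \<Longrightarrow> h < d \<Longrightarrow> y a < y (a + h)"
    using DERIV_pos_inc_right[OF D1] by blast
  define h where "h = min (d / 2) ((c - a) / 2)"
  have "0 < h" "h < d" "a + h < c"
    using d ac by (auto simp: h_def min_def field_simps)
  then show False
    using d(2)[of h] left[of "a + h"] ac by simp
qed

lemma poly_neg_left_of_root:
  fixes p :: "real poly"
  assumes "poly p c = 0" "0 < poly (pderiv p) c" "\<And>t. a < t \<Longrightarrow> t < c \<Longrightarrow> poly p t \<noteq> 0"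
    and t: "a < t" "t < c"
  shows "poly p t < 0"
proof (rule ccontr)
  assume "\<not> poly p t < 0"
  then have pos: "0 < poly p t"
    using assms(3)[OF t] by simp
  obtain d where d: "d > 0" "\<And>h. 0 < h \<Longrightarrow> h < d \<Longrightarrow> poly p (c - h) < poly p c"
    using DERIV_pos_inc_left[OF poly_DERIV assms(2)] by blast
  define h where "h = min (d / 2) ((c - t) / 2)"
  have "0 < h" "h < d" "t < c - h"
    using d t by (auto simp: h_def min_def field_simps)
  then obtain z where "t < z" "z < c - h" "poly p z = 0"
    using poly_IVT_neg[of t "c - h" p] pos d(2)[of h] assms(1) by auto
  then show False
    using assms(3)[of z] t \<open>0 < h\<close> by auto
qed

lemma poly_pos_right_of_root:
  fixes p :: "real poly"
  assumes "poly p c = 0" "0 < poly (pderiv p) c" "\<And>t. c < t \<Longrightarrow> t < b \<Longrightarrow> poly p t \<noteq> 0"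
    and t: "c < t" "t < b"
  shows "0 < poly p t"
proof (rule ccontr)
  assume "\<not> 0 < poly p t"
  then have neg: "poly p t < 0"
    using assms(3)[OF t] by simp
  obtain d where d: "d > 0" "\<And>h. 0 < h \<Longrightarrow> h < d \<Longrightarrow> poly p c < poly p (c + h)"
    using DERIV_pos_inc_right[OF poly_DERIV assms(2)] by blast
  define h where "h = min (d / 2) ((t - c) / 2)"
  have "0 < h" "h < d" "c + h < t"
    using d t by (auto simp: h_def min_def field_simps)
  then obtain z where "c + h < z" "z < t" "poly p z = 0"
    using poly_IVT_neg[of "c + h" t p] neg d(2)[of h] assms(1) by auto
  then show False
    using assms(3)[of z] t \<open>0 < h\<close> by auto
qed

text \<open>The function \<open>y = exp (- t\<^sup>2 / 2) * H\<close> satisfies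
  \<open>y'' = - (2 * n + 1 - t\<^sup>2) * y\<close>. As \<open>c \<le> 0\<close>, the coefficient
  at \<open>c + t\<close> is at least that at \<open>c - t\<close>, so oscillation is faster on the
  right and a longer right gap is impossible.\<close>

lemma hermite_gap_le:
  assumes zeros: "a \<in> hermite_zeros n" "c \<in> hermite_zeros n"
    and "a < c" "c < b" "c \<le> 0"
    and ac: "\<And>t. a < t \<Longrightarrow> t < c \<Longrightarrow> t \<notin> hermite_zeros n"
    and cb: "\<And>t. c < t \<Longrightarrow> t < b \<Longrightarrow> t \<notin> hermite_zeros n"
  shows "b - c \<le> c - a"
proof (rule ccontr)
  assume far: "\<not> b - c \<le> c - a"
  \<comment> \<open>The sign is normalized so that the function increases through
    \<open>c\<close>.\<close>
  define s where "s = sgn (poly (pderiv (hermite n)) c)"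
  define p where "p = smult s (hermite n)"
  have s: "s \<noteq> 0"
    using pderiv_hermite_root_nonzero[OF zeros(2)] by (simp add: s_def sgn_eq_0_iff)
  have p: "poly p t = 0 \<longleftrightarrow> t \<in> hermite_zeros n" for t
    using s by (simp add: p_def hermite_zeros_def)
  have ode: "poly (pderiv (pderiv p)) t = 2 * t * poly (pderiv p) t - 2 * real n * poly p t" for t
    by (simp add: p_def pderiv_smult hermite_ode algebra_simps)
  have p'c: "0 < poly (pderiv p) c"
    using pderiv_hermite_root_nonzero[OF zeros(2)] by (simp add: p_def pderiv_smult s_def sgn_real_def)
  have p'a: "poly (pderiv p) a \<noteq> 0"
    using pderiv_hermite_root_nonzero[OF zeros(1)] s by (simp add: p_def pderiv_smult)
  define y where "y t = exp (- t\<^sup>2 / 2) * poly p t" for t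
  define y' where "y' t = exp (- t\<^sup>2 / 2) * (poly (pderiv p) t - t * poly p t)" for t
  have D1: "(y has_real_derivative y' t) (at t)" for t
    unfolding y_def y'_def by (auto intro!: derivative_eq_intros simp: algebra_simps power2_eq_square)
  have D2: "(y' has_real_derivative - (2 * real n + 1 - t\<^sup>2) * y t) (at t)" for t
    unfolding y_def y'_def
    by (auto intro!: derivative_eq_intros simp: ode algebra_simps power2_eq_square)
  show False
  proof (rule sturm_reflection[OF D1 D2 \<open>a < c\<close>])
    show "y a = 0" "y c = 0"
      using zeros p by (simp_all add: y_def)
    show "y' a \<noteq> 0"
      using p[of a] zeros p'a by (simp add: y'_def)
    show "y t < 0" if "a < t" "t < c" for t
      using poly_neg_left_of_root[of p c a t] p p'c ac zeros that by (simp add: y_def mult_pos_neg)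
    show "0 < y t" if "c < t" "t \<le> 2 * c - a" for t
      using poly_pos_right_of_root[of p c b t] p p'c cb zeros that far by (simp add: y_def)
    show "2 * real n + 1 - (c - t)\<^sup>2 \<le> 2 * real n + 1 - (c + t)\<^sup>2" if "0 \<le> t" for t
      using that \<open>c \<le> 0\<close> mult_nonneg_nonpos[of t c] by (simp add: power2_eq_square algebra_simps)
  qed
qed

section \<open>The zeros as an indexed balanced configuration\<close>

lemma hermite_root_eq_nth: "hermite_root n i = sorted_list_of_set (hermite_zeros n) ! (i - 1)"
  by (simp add: hermite_root_def hermite_zeros_def)

lemma hermite_root_less:
  assumes "1 \<le> i" "i < j" "j \<le> n"
  shows "hermite_root n i < hermite_root n j"
  unfolding hermite_root_eq_nth
  using assms by (intro sorted_wrt_nth_less[OF strict_sorted_list_of_set]) (auto simp: card_hermite_zeros)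

lemma bij_betw_hermite_root: "bij_betw (hermite_root n) {1..n} (hermite_zeros n)"
proof (rule bij_betw_imageI)
  show "inj_on (hermite_root n) {1..n}"
  proof (rule linorder_inj_onI)
    show "hermite_root n i \<noteq> hermite_root n j" if "i < j" "i \<in> {1..n}" "j \<in> {1..n}" for i j
      using hermite_root_less[of i j n] that by auto
  qed auto
  have "hermite_zeros n = (!) (sorted_list_of_set (hermite_zeros n)) ` {..<n}"
    using nth_image[of n "sorted_list_of_set (hermite_zeros n)"] by (simp add: card_hermite_zeros lessThan_atLeast0)
  also have "{..<n} = (\<lambda>i. i - 1) ` {1..n}"
    by (auto simp: image_iff intro!: bexI[of _ "Suc _"])
  finally show "hermite_root n ` {1..n} = hermite_zeros n"
    unfolding image_image hermite_root_eq_nth[symmetric] by simp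
qed

lemma hermite_root_mem: "1 \<le> i \<Longrightarrow> i \<le> n \<Longrightarrow> hermite_root n i \<in> hermite_zeros n"
  using bij_betwE[OF bij_betw_hermite_root] by simp

text \<open>Reversing and negating the sorted list of zeros gives a strictly sorted list of the same
  set, hence the same list.\<close>

lemma hermite_root_mirror:
  assumes "1 \<le> i" "i \<le> n"
  shows "hermite_root n (n + 1 - i) = - hermite_root n i"
proof -
  define xs where "xs = sorted_list_of_set (hermite_zeros n)"
  have len: "length xs = n" and set: "set xs = hermite_zeros n" and sorted: "sorted_wrt (<) xs"
    by (simp_all add: xs_def card_hermite_zeros)
  have "sorted_wrt (<) (map uminus (rev xs))"
    using sorted by (simp add: sorted_wrt_map sorted_wrt_rev)
  moreover have "set (map uminus (rev xs)) = hermite_zeros n"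
  proof -
    have "uminus ` hermite_zeros n = hermite_zeros n"
      using uminus_hermite_zeros[of _ n] by (force simp: image_iff)
    then show ?thesis
      by (simp add: set)
  qed
  ultimately have eq: "map uminus (rev xs) = xs"
    using sorted set strict_sorted_equal by blast
  have "xs ! (n - i) = map uminus (rev xs) ! (n - i)"
    by (simp add: eq)
  also have "\<dots> = - xs ! (i - 1)"
    using assms len by (simp add: rev_nth)
  finally show ?thesis
    using assms by (simp add: hermite_root_eq_nth xs_def)
qed

lemma hermite_root_consecutive:
  assumes "1 \<le> i" "i < n" "hermite_root n i < t" "t < hermite_root n (i + 1)"
  shows "t \<notin> hermite_zeros n"
proof
  assume "t \<in> hermite_zeros n"
  then obtain j where j: "j \<in> {1..n}" "t = hermite_root n j"
    using bij_betw_imp_surj_on[OF bij_betw_hermite_root[of n]] by blast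
  then have "j \<noteq> i" "j \<noteq> i + 1" "\<not> j < i" "\<not> i + 1 < j"
    using assms hermite_root_less[of j i n] hermite_root_less[of "i + 1" j n] by auto
  then show False
    by simp
qed

text \<open>The bound on \<open>i\<close> puts the middle index \<open>i + 1\<close> in the left
  half, where its zero is nonpositive and \<open>hermite_gap_le\<close> applies.\<close>

lemma hermite_root_gap_Suc:
  assumes "1 \<le> i" "2 * i + 1 \<le> n"
  shows "hermite_root n (i + 2) - hermite_root n (i + 1) \<le> hermite_root n (i + 1) - hermite_root n i"
proof (rule hermite_gap_le[where n = n])
  have "hermite_root n (i + 1) \<le> hermite_root n (n + 1 - (i + 1))"
  proof (cases "i + 1 = n - i")
    case False
    then have "i + 1 < n - i"
      using assms(2) by linarith
    then show ?thesis
      using hermite_root_less[of "i + 1" "n - i" n] by simp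
  qed simp
  then show "hermite_root n (i + 1) \<le> 0"
    using hermite_root_mirror[of "i + 1" n] assms by simp
qed (use assms hermite_root_mem hermite_root_less hermite_root_consecutive[of i n]
    hermite_root_consecutive[of "i + 1" n] in auto)

text \<open>Left of the centre, neighbouring gaps are compared successively. A gap \<open>j\<close>
  right of the centre equals its mirror image, gap \<open>n - j\<close>, and
  \<open>i \<le> n - j\<close>.\<close>

lemma hermite_root_gap:
  assumes "1 \<le> i" "i \<le> j" "i + j \<le> n"
  shows "hermite_root n (j + 1) - hermite_root n j \<le> hermite_root n (i + 1) - hermite_root n i"
proof -
  have left: "hermite_root n (k + 1) - hermite_root n k \<le> hermite_root n (i + 1) - hermite_root n i"
    if "i \<le> k" "2 * k \<le> n" for k
    using that
  proof (induction k rule: dec_induct)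
    case (step k)
    then show ?case
      using hermite_root_gap_Suc[of k n] assms(1) by simp
  qed simp
  show ?thesis
  proof (cases "2 * j \<le> n")
    case True
    then show ?thesis
      using left assms by simp
  next
    case False
    have "hermite_root n (n + 1 - (j + 1)) = - hermite_root n (j + 1)"
      "hermite_root n (n + 1 - j) = - hermite_root n j"
      using assms by (intro hermite_root_mirror; simp)+
    moreover have "n + 1 - (j + 1) = n - j" "n + 1 - j = n - j + 1"
      using assms by auto
    ultimately show ?thesis
      using left[of "n - j"] False assms by simp
  qed
qed

lemma hermite_root_balance:
  assumes "1 \<le> i" "i \<le> n"
  shows "(\<Sum>j\<in>{1..n} - {i}. 1 / (hermite_root n i - hermite_root n j)) = hermite_root n i"
proof -
  have "bij_betw (hermite_root n) ({1..n} - {i}) (hermite_zeros n - {hermite_root n i})"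
    using assms by (intro bij_betw_DiffI bij_betw_hermite_root) (auto simp: bij_betw_def hermite_root_mem)
  from sum.reindex_bij_betw[OF this, of "\<lambda>b. 1 / (hermite_root n i - b)"]
  show ?thesis
    using hermite_zeros_balance[OF hermite_root_mem[OF assms]] by simp
qed

lemma balanced_points_hermite_root: "balanced_points n (hermite_root n)"
  by unfold_locales (use hermite_root_less hermite_root_mirror hermite_root_gap hermite_root_balance in auto)

theorem theorem3:
  fixes n m :: nat and S :: "nat set"
  assumes "n \<ge> 1" and "S \<subseteq> {1..n}" and "m = card S"
  shows "(\<Sum>i\<in>S. \<Sum>j\<in>{1..n} - S. 1 / \<bar>scaled_hermite_root n i - scaled_hermite_root n j\<bar>)
       \<ge> (\<Sum>i\<in>{1..m}. \<Sum>j\<in>{1..n} - {1..m}. 1 / \<bar>scaled_hermite_root n i - scaled_hermite_root n j\<bar>)"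
proof -
  interpret balanced_points n "hermite_root n"
    by (rule balanced_points_hermite_root)
  define s where "s = (2 * real n) powr (- 1 / 2)"
  have "0 < s"
    using assms(1) by (simp add: s_def)
  \<comment> \<open>Scaling multiplies every weight, hence every cut, by the same positive factor
    \<open>1 / s\<close>.\<close>
  then have "1 / \<bar>scaled_hermite_root n i - scaled_hermite_root n j\<bar> = (1 / s) * w i j" for i j
    unfolding scaled_hermite_root_def s_def [symmetric] w_def
    by (simp add: right_diff_distrib [symmetric] abs_mult)
  then have "(\<Sum>i\<in>A. \<Sum>j\<in>{1..n} - A. 1 / \<bar>scaled_hermite_root n i - scaled_hermite_root n j\<bar>) = (1 / s) * cut A" for A
    by (simp only: cut_def sum_distrib_left)
  then show ?thesis
    using cut_ge_initial[OF assms(2)] assms(3) \<open>0 < s\<close> by (simp add: divide_right_mono)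
qed

end
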